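(* Let $m,n,s$ be integers with $2\le 2s\le m\le n$ and let $\mathbf A$ be a real $m\times n$ matrix. Then the following statement (v) is equivalent to each of the statements (i)--(iv) below (so that all five are equivalent): (i) The measurement $\mathbf A\mathbf x$ uniquely determines each $s$-sparse vector $\mathbf x$; that is, if $\mathbf x,\mathbf x'\in\Sigma_s$ and $\mathbf A\mathbf x=\mathbf A\mathbf x'$, then $\mathbf x=\mathbf x'$. (ii) There is a map $\Delta:\mathbb R^m\to\mathbb R^n$ such that $\Delta(\mathbf A\mathbf x)=\mathbf x$ for all $\mathbf x\in\Sigma_s$. (iii) The only $2s$-sparse vector $\mathbf y$ with $\mathbf A\mathbf y=\mathbf 0$ is the zero vector. (iv) There exist positive constants $\alpha_{2s},\beta_{2s}$ such that $\alpha_{2s}\|\mathbf x\|_2\le\|\mathbf A\mathbf x\|_2\le\beta_{2s}\|\mathbf x\|_2$ for all $\mathbf x\in\Sigma_{2s}$. (v) There exists $0<q\le 1$ such that the decoder $\Delta(\mathbf z):=\operatorname{argmin}_{\mathbf A\mathbf y=\mathbf z}\|\mathbf y\|_q$ satisfies $\Delta(\mathbf A\mathbf x)=\mathbf x$ for all $\mathbf x\in\Sigma_s$; that is, for every $\mathbf x\in\Sigma_s$, $\mathbf x$ is the unique minimizer of $\|\mathbf y\|_q$ over all $\mathbf y\in\mathbb R^n$ with $\mathbf A\mathbf y=\mathbf A\mathbf x$.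
   Context: For $\mathbf x=(x_1,\dots,x_n)^T\in\mathbb R^n$, $\|\mathbf x\|_0$ is the number of nonzero components of $\mathbf x$, and $\|\mathbf x\|_q=(|x_1|^q+\cdots+|x_n|^q)^{1/q}$ for $0<q<\infty$. A vector $\mathbf x$ is $s$-sparse if $\|\mathbf x\|_0\le s$; $\Sigma_s$ denotes the set of all $s$-sparse vectors in $\mathbb R^n$. *)

theory Defs
  imports "HOL-Analysis.Analysis"
begin

definition l0_norm :: "real ^ 'n \<Rightarrow> nat" where
  "l0_norm x = card {i. x $ i \<noteq> 0}"

definition lq_norm :: "real \<Rightarrow> real ^ 'n \<Rightarrow> real" where
  "lq_norm q x = (\<Sum>i\<in>UNIV. \<bar>x $ i\<bar> powr q) powr (1 / q)"

lemma lq_norm_2_eq_norm: "lq_norm 2 x = norm x"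
proof -
  have "(\<Sum>i\<in>UNIV. \<bar>x $ i\<bar> powr 2) = (\<Sum>i\<in>UNIV. (x $ i)\<^sup>2)"
    by (intro sum.cong) auto
  then show ?thesis
    by (simp add: lq_norm_def norm_vec_def L2_set_def powr_half_sqrt sum_nonneg)
qed

definition sparse_vectors :: "nat \<Rightarrow> (real ^ 'n) set" where
  "sparse_vectors s = {x. l0_norm x \<le> s}"

(* The set of all minimizers; the decoder is well defined at z, with value x,
   exactly if this set is {x}. *)
definition lq_argmin :: "real \<Rightarrow> real ^ 'n ^ 'm \<Rightarrow> real ^ 'm \<Rightarrow> (real ^ 'n) set" where
  "lq_argmin q A z = {y. is_arg_min (lq_norm q) (\<lambda>y. A *v y = z) y}"

end

(* Everything reduces to (iv) ==> (v). If A is bounded below on 2s-sparse vectors, then no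
   nonzero kernel vector is even close to being 2s-sparse: there is c > 0 such that every unit
   vector of ker A has more than 2s entries of modulus at least c. Choose q so small that
   (s + 1) c^q > s. For a kernel vector h and any set S of at most s indices, the q-mass of h
   on S is at most s, while off S there remain at least s + 1 large entries. This is the null
   space property of order q, which by subadditivity of t |-> t^q gives the unique
   recovery of every s-sparse vector. *)

theory Submission
  imports Defs
begin

definition restrict_vec :: "'n set \<Rightarrow> real ^ 'n \<Rightarrow> real ^ 'n" where
  "restrict_vec T x = (\<chi> i. if i \<in> T then x $ i else 0)"

lemma restrict_vec_nth [simp]: "restrict_vec T x $ i = (if i \<in> T then x $ i else 0)"
  by (simp add: restrict_vec_def)

lemma restrict_vec_decomp: "restrict_vec T x + restrict_vec (- T) x = x"
  by (simp add: vec_eq_iff)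

text \<open>Any index set of size at most \<open>k\<close> that covers the support will do. This
  freedom lets restrictions and multiples be handled without computing exact supports.\<close>

lemma sparse_vectors_iff:
  "x \<in> sparse_vectors k \<longleftrightarrow> (\<exists>T. card T \<le> k \<and> (\<forall>i. i \<notin> T \<longrightarrow> x $ i = 0))"
proof
  assume "x \<in> sparse_vectors k"
  then show "\<exists>T. card T \<le> k \<and> (\<forall>i. i \<notin> T \<longrightarrow> x $ i = 0)"
    by (intro exI[of _ "{i. x $ i \<noteq> 0}"]) (simp add: sparse_vectors_def l0_norm_def)
next
  assume "\<exists>T. card T \<le> k \<and> (\<forall>i. i \<notin> T \<longrightarrow> x $ i = 0)"
  then obtain T where "card T \<le> k" "\<And>i. i \<notin> T \<Longrightarrow> x $ i = 0" by auto
  moreover have "{i. x $ i \<noteq> 0} \<subseteq> T" using calculation by auto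
  ultimately show "x \<in> sparse_vectors k"
    using card_mono[of T "{i. x $ i \<noteq> 0}"] by (simp add: sparse_vectors_def l0_norm_def)
qed

lemma restrict_vec_sparse: "card T \<le> k \<Longrightarrow> restrict_vec T x \<in> sparse_vectors k"
  by (auto simp: sparse_vectors_iff)

text \<open>The set is a finite union of coordinate subspaces. Closedness is what makes its
  intersection with the unit sphere compact.\<close>

lemma closed_sparse_vectors: "closed (sparse_vectors k :: (real ^ 'n) set)"
proof -
  have "sparse_vectors k = (\<Union>T \<in> {T :: 'n set. card T \<le> k}. \<Inter>i \<in> - T. {x. x $ i = 0})"
    by (simp add: set_eq_iff sparse_vectors_iff) (metis ComplD ComplI)
  moreover have "closed \<dots>"
    by (intro closed_UN closed_INT ballI closed_Collect_eq continuous_intros) simp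
  ultimately show ?thesis by simp
qed

lemma scaleR_sparse: "x \<in> sparse_vectors k \<Longrightarrow> r *\<^sub>R x \<in> sparse_vectors k"
  by (auto simp: sparse_vectors_iff)

text \<open>A 2s-sparse kernel vector is a difference of two s-sparse vectors, obtained by cutting
  its support in two; both have the same image under \<open>A\<close>, so they coincide.\<close>

lemma sparse_injective_imp_kernel_trivial:
  fixes A :: "real ^ 'n ^ 'm"
  assumes inj: "\<And>x x'. x \<in> sparse_vectors s \<Longrightarrow> x' \<in> sparse_vectors s \<Longrightarrow> A *v x = A *v x' \<Longrightarrow> x = x'"
    and y: "y \<in> sparse_vectors (2 * s)" and Ay: "A *v y = 0"
  shows "y = 0"
proof -
  obtain T where T: "card T \<le> 2 * s" "\<And>i. i \<notin> T \<Longrightarrow> y $ i = 0"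
    using y by (auto simp: sparse_vectors_iff)
  \<comment> \<open>The minimum covers the case of a \<open>T\<close> with fewer than
    \<open>s\<close> elements, where \<open>U\<close> is all of \<open>T\<close>.\<close>
  obtain U where U: "U \<subseteq> T" "card U = min s (card T)"
    using obtain_subset_with_card_n[of "min s (card T)" T] by auto
  have "card (T - U) \<le> s"
    using U T(1) by (simp add: card_Diff_subset finite_subset)
  then have "restrict_vec (T - U) (- y) \<in> sparse_vectors s"
    by (rule restrict_vec_sparse)
  moreover have "restrict_vec U y \<in> sparse_vectors s"
    using U by (intro restrict_vec_sparse) simp
  moreover have eq: "restrict_vec U y - restrict_vec (T - U) (- y) = y"
    using T(2) U(1) by (auto simp: vec_eq_iff)
  then have "A *v restrict_vec U y = A *v restrict_vec (T - U) (- y)"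
    using Ay by (metis matrix_vector_mult_diff_distrib eq_iff_diff_eq_0)
  ultimately have "restrict_vec U y = restrict_vec (T - U) (- y)"
    by (intro inj)
  with eq show ?thesis by simp
qed

text \<open>On the compact set of sparse unit vectors the continuous function
  \<open>norm (A *v x)\<close> attains its minimum, which is positive because the kernel contains
  none of them. Homogeneity extends the bound to all sparse vectors.\<close>

lemma kernel_trivial_imp_bounded_below:
  fixes A :: "real ^ 'n ^ 'm"
  assumes ker: "\<And>y. y \<in> sparse_vectors k \<Longrightarrow> A *v y = 0 \<Longrightarrow> y = 0"
  obtains \<alpha> where "\<alpha> > 0" "\<And>x. x \<in> sparse_vectors k \<Longrightarrow> \<alpha> * norm x \<le> norm (A *v x)"
proof -
  define K where "K = sphere (0 :: real ^ 'n) 1 \<inter> sparse_vectors k"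
  have "compact K"
    unfolding K_def by (intro compact_Int_closed compact_sphere closed_sparse_vectors)
  have cont: "continuous_on K (\<lambda>x. norm (A *v x))"
    by (intro continuous_intros)
  obtain \<alpha> where \<alpha>: "\<alpha> > 0" "\<And>x. x \<in> K \<Longrightarrow> \<alpha> \<le> norm (A *v x)"
  \<comment> \<open>For \<open>k = 0\<close> there are no sparse unit vectors, and any positive
    constant serves.\<close>
  proof (cases "K = {}")
    case True
    then show ?thesis using that[of 1] by simp
  next
    case False
    obtain z where z: "z \<in> K" "\<And>x. x \<in> K \<Longrightarrow> norm (A *v z) \<le> norm (A *v x)"
      using continuous_attains_inf[OF \<open>compact K\<close> False cont] by auto
    have "A *v z \<noteq> 0" using z(1) ker[of z] by (auto simp: K_def)
    then show ?thesis using that[of "norm (A *v z)"] z(2) by simp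
  qed
  have "\<alpha> * norm x \<le> norm (A *v x)" if "x \<in> sparse_vectors k" for x
  proof (cases "x = 0")
    case False
    have "(1 / norm x) *\<^sub>R x \<in> K"
      using False that by (simp add: K_def scaleR_sparse)
    then have "\<alpha> \<le> norm (A *v x) / norm x"
      using \<alpha>(2) by (fastforce simp: matrix_vector_mult_scaleR)
    then show ?thesis using False by (simp add: pos_le_divide_eq)
  qed simp
  with \<alpha>(1) show ?thesis by (rule that)
qed

text \<open>Otherwise \<open>h = u + v\<close> with \<open>u\<close> the k-sparse part of large
  entries and \<open>v\<close> the small rest. Since \<open>A\<close> maps \<open>u\<close> and
  \<open>v\<close> to opposite vectors, the lower bound on \<open>u\<close> controls
  \<open>norm u\<close> by a multiple of \<open>norm v\<close>, so \<open>h\<close> would be too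
  short to be a unit vector.\<close>

lemma kernel_unit_many_large_entries:
  fixes A :: "real ^ 'n ^ 'm"
  assumes \<alpha>: "\<alpha> > 0" "\<And>x. x \<in> sparse_vectors k \<Longrightarrow> \<alpha> * norm x \<le> norm (A *v x)"
  obtains c where "c > 0"
    "\<And>h. A *v h = 0 \<Longrightarrow> norm h = 1 \<Longrightarrow> k < card {i. c \<le> \<bar>h $ i\<bar>}"
proof -
  obtain B where B: "B > 0" "\<And>x. norm (A *v x) \<le> norm x * B"
    using bounded_linear.pos_bounded[OF matrix_vector_mul_bounded_linear[of A]] by auto
  define N where "N = real CARD('n)"
  have "N > 0" by (simp add: N_def)
  \<comment> \<open>Chosen so that \<open>N * c * (B / \<alpha> + 1)\<close> is 1/2, whereas the
    argument below would force it to be at least 1.\<close>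
  define c where "c = 1 / (2 * N * (B / \<alpha> + 1))"
  have "B / \<alpha> + 1 > 0" using B \<alpha> by (simp add: add_pos_pos)
  then have "c > 0" using \<open>N > 0\<close> by (simp add: c_def)
  have "k < card {i. c \<le> \<bar>h $ i\<bar>}" if h: "A *v h = 0" "norm h = 1" for h
  proof (rule ccontr)
    define T where "T = {i. c \<le> \<bar>h $ i\<bar>}"
    define u where "u = restrict_vec T h"
    define v where "v = restrict_vec (- T) h"
    assume "\<not> k < card {i. c \<le> \<bar>h $ i\<bar>}"
    then have "u \<in> sparse_vectors k"
      by (simp add: restrict_vec_sparse u_def T_def)
    have uv: "u + v = h" unfolding u_def v_def by (rule restrict_vec_decomp)
    have "A *v u + A *v v = 0"
      using h(1) uv by (metis matrix_vector_right_distrib)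
    then have "norm (A *v u) = norm (A *v v)"
      by (metis add.inverse_unique norm_minus_cancel)
    then have "\<alpha> * norm u \<le> norm v * B"
      using \<alpha>(2)[OF \<open>u \<in> _\<close>] B(2)[of v] by simp
    then have "norm u \<le> norm v * B / \<alpha>"
      using \<alpha>(1) by (simp add: pos_le_divide_eq mult.commute)
    moreover have "1 \<le> norm u + norm v"
      using norm_triangle_ineq[of u v] uv h(2) by simp
    ultimately have "1 \<le> norm v * (B / \<alpha> + 1)"
      by (simp add: algebra_simps)
    also have "norm v \<le> (\<Sum>i\<in>UNIV. \<bar>v $ i\<bar>)" by (rule norm_le_l1_cart)
    also have "\<dots> \<le> (\<Sum>i\<in>(UNIV :: 'n set). c)"
      using \<open>c > 0\<close> by (intro sum_mono) (auto simp: v_def T_def)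
    also have "\<dots> = N * c" by (simp add: N_def)
    finally have "1 \<le> N * c * (B / \<alpha> + 1)"
      using \<open>B / \<alpha> + 1 > 0\<close> by simp
    also have "\<dots> = 1 / 2"
      using \<open>N > 0\<close> \<open>B / \<alpha> + 1 > 0\<close> by (simp add: c_def)
    finally show False by simp
  qed
  with \<open>c > 0\<close> show ?thesis by (rule that)
qed

text \<open>As q decreases to 0, \<open>c powr q\<close> tends to 1, so the right-hand side tends to
  \<open>s + 1\<close>, which exceeds \<open>s\<close>.\<close>

lemma exists_small_exponent:
  fixes c :: real
  assumes "c > 0"
  obtains q where "0 < q" "q \<le> 1" "real s < (real s + 1) * c powr q"
proof -
  have "((\<lambda>q. (real s + 1) * c powr q) \<longlongrightarrow> (real s + 1) * c powr 0) (at_right 0)"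
    using assms by (intro tendsto_intros) auto
  then have "((\<lambda>q. (real s + 1) * c powr q) \<longlongrightarrow> real s + 1) (at_right 0)"
    using assms by simp
  then have "\<forall>\<^sub>F q in at_right 0. real s < (real s + 1) * c powr q"
    by (rule order_tendstoD) simp
  moreover have "\<forall>\<^sub>F q in at_right 0. q \<in> {0 <..< (1 :: real)}"
    by (rule eventually_at_right_real) simp
  ultimately have "\<forall>\<^sub>F q in at_right (0 :: real). 0 < q \<and> q \<le> 1 \<and> real s < (real s + 1) * c powr q"
    by eventually_elim auto
  then show ?thesis
    using eventually_happens trivial_limit_at_right_real that by blast
qed

lemma null_space_property_unit:
  fixes h :: "real ^ 'n"
  assumes "norm h = 1" and "card S \<le> s" and "c > 0" and "q > 0"
    and large: "2 * s < card {i. c \<le> \<bar>h $ i\<bar>}"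
    and q: "real s < (real s + 1) * c powr q"
  shows "(\<Sum>i\<in>S. \<bar>h $ i\<bar> powr q) < (\<Sum>i\<in>- S. \<bar>h $ i\<bar> powr q)"
proof -
  define L where "L = {i. c \<le> \<bar>h $ i\<bar>}"
  have "(\<Sum>i\<in>S. \<bar>h $ i\<bar> powr q) \<le> (\<Sum>i\<in>S. 1)"
  proof (rule sum_mono)
    fix i
    have "\<bar>h $ i\<bar> \<le> 1" using component_le_norm_cart[of h i] assms(1) by simp
    then show "\<bar>h $ i\<bar> powr q \<le> 1"
      using powr_mono2[of q "\<bar>h $ i\<bar>" 1] \<open>q > 0\<close> by simp
  qed
  also have "\<dots> \<le> real s" using assms(2) by simp
  also have "\<dots> < (real s + 1) * c powr q" by (rule q)
  also have "\<dots> \<le> real (card (L - S)) * c powr q"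
  proof (rule mult_right_mono)
    \<comment> \<open>At least \<open>2 * s + 1\<close> large entries, minus at most
      \<open>s\<close> positions in \<open>S\<close>, leave \<open>s + 1\<close>: one more than
      \<open>S\<close> can hold.\<close>
    have "card L - card S \<le> card (L - S)" by (rule diff_card_le_card_Diff) simp
    then have "s + 1 \<le> card (L - S)" using large assms(2) by (simp add: L_def)
    then show "real s + 1 \<le> real (card (L - S))" by linarith
  qed simp
  also have "\<dots> = (\<Sum>i\<in>L - S. c powr q)" by simp
  also have "\<dots> \<le> (\<Sum>i\<in>L - S. \<bar>h $ i\<bar> powr q)"
    using assms(3,4) by (intro sum_mono powr_mono2) (auto simp: L_def)
  also have "\<dots> \<le> (\<Sum>i\<in>- S. \<bar>h $ i\<bar> powr q)"
    by (intro sum_mono2) auto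
  finally show ?thesis .
qed

text \<open>The threshold \<open>c\<close> depends only on \<open>A\<close> and \<open>s\<close>, so
  a single q works for all \<open>h\<close> and \<open>S\<close> at once.\<close>

lemma null_space_property:
  fixes A :: "real ^ 'n ^ 'm"
  assumes "\<alpha> > 0" "\<And>x. x \<in> sparse_vectors (2 * s) \<Longrightarrow> \<alpha> * norm x \<le> norm (A *v x)"
  obtains q where "0 < q" "q \<le> 1"
    "\<And>h S. A *v h = 0 \<Longrightarrow> h \<noteq> 0 \<Longrightarrow> card S \<le> s \<Longrightarrow>
       (\<Sum>i\<in>S. \<bar>h $ i\<bar> powr q) < (\<Sum>i\<in>- S. \<bar>h $ i\<bar> powr q)"
proof -
  obtain c where c: "c > 0"
    "\<And>h. A *v h = 0 \<Longrightarrow> norm h = 1 \<Longrightarrow> 2 * s < card {i. c \<le> \<bar>h $ i\<bar>}"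
    using kernel_unit_many_large_entries[of \<alpha> "2 * s" A] assms by metis
  obtain q where q: "0 < q" "q \<le> 1" "real s < (real s + 1) * c powr q"
    using exists_small_exponent[OF c(1)] by blast
  have "(\<Sum>i\<in>S. \<bar>h $ i\<bar> powr q) < (\<Sum>i\<in>- S. \<bar>h $ i\<bar> powr q)"
    if "A *v h = 0" "h \<noteq> 0" "card S \<le> s" for h S
  proof -
    \<comment> \<open>Normalizing is harmless: both sums scale by the same positive factor
      \<open>norm h powr q\<close>.\<close>
    define g where "g = (1 / norm h) *\<^sub>R h"
    have g: "norm g = 1" "A *v g = 0"
      using that by (simp_all add: g_def matrix_vector_mult_scaleR)
    have "h $ i = norm h * g $ i" for i
      using that(2) by (simp add: g_def)
    then have "\<bar>h $ i\<bar> powr q = norm h powr q * \<bar>g $ i\<bar> powr q" for i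
      by (metis abs_mult abs_norm_cancel powr_mult)
    moreover have "norm h powr q > 0" using that(2) by simp
    moreover have "(\<Sum>i\<in>S. \<bar>g $ i\<bar> powr q) < (\<Sum>i\<in>- S. \<bar>g $ i\<bar> powr q)"
      using null_space_property_unit[OF g(1) that(3) c(1) q(1) c(2)[OF g(2,1)] q(3)] .
    ultimately show ?thesis
      by (simp flip: sum_distrib_left)
  qed
  with q(1,2) show ?thesis by (rule that)
qed

text \<open>The fractions \<open>a / (a + b)\<close> and \<open>b / (a + b)\<close> lie in [0,1] and
  add up to 1; there t \<le> t^q, so their q-th powers add up to at least 1.\<close>

lemma powr_subadditive:
  fixes a b q :: real
  assumes "0 \<le> a" "0 \<le> b" "0 < q" "q \<le> 1"
  shows "(a + b) powr q \<le> a powr q + b powr q"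
proof (cases "a + b = 0")
  case False
  then have pos: "a + b > 0" using assms by simp
  have ge: "t \<le> t powr q" if "0 \<le> t" "t \<le> 1" for t :: real
    using powr_mono'[of q 1 t] that assms by simp
  have "1 = a / (a + b) + b / (a + b)"
    using pos by (simp flip: add_divide_distrib)
  also have "\<dots> \<le> (a / (a + b)) powr q + (b / (a + b)) powr q"
    using assms pos by (intro add_mono ge) auto
  also have "\<dots> = (a powr q + b powr q) / (a + b) powr q"
    using assms by (simp add: powr_divide add_divide_distrib)
  finally show ?thesis using pos by (simp add: pos_le_divide_eq)
qed (use assms in simp)

text \<open>Passing from \<open>x\<close> to \<open>x + h\<close> loses at most the q-mass of
  \<open>h\<close> on \<open>S\<close> and gains all of its q-mass off \<open>S\<close>, where
  \<open>x\<close> vanishes; the null space property says that the gain is larger.\<close>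

lemma sparse_unique_minimizer:
  fixes A :: "real ^ 'n ^ 'm"
  assumes q: "0 < q" "q \<le> 1"
    and nsp: "\<And>h S. A *v h = 0 \<Longrightarrow> h \<noteq> 0 \<Longrightarrow> card S \<le> s \<Longrightarrow>
       (\<Sum>i\<in>S. \<bar>h $ i\<bar> powr q) < (\<Sum>i\<in>- S. \<bar>h $ i\<bar> powr q)"
    and x: "x \<in> sparse_vectors s"
  shows "lq_argmin q A (A *v x) = {x}"
proof -
  obtain S where S: "card S \<le> s" "\<And>i. i \<notin> S \<Longrightarrow> x $ i = 0"
    using x by (auto simp: sparse_vectors_iff)
  have split: "(\<Sum>i\<in>UNIV. f i) = (\<Sum>i\<in>S. f i) + (\<Sum>i\<in>- S. f i)" for f :: "'n \<Rightarrow> real"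
    using sum.subset_diff[of S UNIV f] by (simp add: Compl_eq_Diff_UNIV)
  have less: "lq_norm q x < lq_norm q y" if y: "A *v y = A *v x" "y \<noteq> x" for y
  proof -
    define h where "h = y - x"
    have "A *v h = 0" "h \<noteq> 0"
      using y by (simp_all add: h_def matrix_vector_mult_diff_distrib)
    have "(\<Sum>i\<in>UNIV. \<bar>x $ i\<bar> powr q) = (\<Sum>i\<in>S. \<bar>x $ i\<bar> powr q)"
      using S(2) by (simp add: split)
    also have "\<dots> \<le> (\<Sum>i\<in>S. \<bar>y $ i\<bar> powr q + \<bar>h $ i\<bar> powr q)"
    proof (rule sum_mono)
      fix i
      have "\<bar>x $ i\<bar> powr q \<le> (\<bar>y $ i\<bar> + \<bar>h $ i\<bar>) powr q"
        using q by (intro powr_mono2) (auto simp: h_def)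
      also have "\<dots> \<le> \<bar>y $ i\<bar> powr q + \<bar>h $ i\<bar> powr q"
        using q by (intro powr_subadditive) auto
      finally show "\<bar>x $ i\<bar> powr q \<le> \<bar>y $ i\<bar> powr q + \<bar>h $ i\<bar> powr q" .
    qed
    also have "\<dots> < (\<Sum>i\<in>S. \<bar>y $ i\<bar> powr q) + (\<Sum>i\<in>- S. \<bar>h $ i\<bar> powr q)"
      using nsp[OF \<open>A *v h = 0\<close> \<open>h \<noteq> 0\<close> S(1)] by (simp add: sum.distrib)
    \<comment> \<open>Off \<open>S\<close> the vectors \<open>h\<close> and \<open>y\<close>
      agree.\<close>
    also have "\<dots> = (\<Sum>i\<in>UNIV. \<bar>y $ i\<bar> powr q)"
      using S(2) by (simp add: split h_def)
    \<comment> \<open>The outer power \<open>1 / q\<close> is strictly increasing, so comparing the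
      sums suffices.\<close>
    finally show ?thesis
      unfolding lq_norm_def using q by (intro powr_less_mono2) (auto intro: sum_nonneg)
  qed
  have "y = x \<longleftrightarrow> is_arg_min (lq_norm q) (\<lambda>y. A *v y = A *v x) y" for y
    using less unfolding is_arg_min_def by (metis less_asym)
  then show ?thesis by (auto simp: lq_argmin_def)
qed

theorem mainTheorem1:
  fixes A :: "real ^ 'n ^ 'm" and s :: nat
  assumes "2 \<le> 2 * s" and "2 * s \<le> CARD('m)" and "CARD('m) \<le> CARD('n)"
  defines "stmt_i \<equiv> (\<forall>x \<in> sparse_vectors s. \<forall>x' \<in> sparse_vectors s. A *v x = A *v x' \<longrightarrow> x = x')"
    and "stmt_ii \<equiv> (\<exists>\<Delta> :: real ^ 'm \<Rightarrow> real ^ 'n. \<forall>x \<in> sparse_vectors s. \<Delta> (A *v x) = x)"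
    and "stmt_iii \<equiv> (\<forall>y \<in> sparse_vectors (2 * s). A *v y = 0 \<longrightarrow> y = 0)"
    and "stmt_iv \<equiv> (\<exists>\<alpha> > 0. \<exists>\<beta> > 0. \<forall>x \<in> sparse_vectors (2 * s).
                      \<alpha> * norm x \<le> norm (A *v x) \<and> norm (A *v x) \<le> \<beta> * norm x)"
    and "stmt_v \<equiv> (\<exists>q :: real. 0 < q \<and> q \<le> 1 \<and>
                      (\<forall>x \<in> sparse_vectors s. lq_argmin q A (A *v x) = {x}))"
  shows "(stmt_v \<longleftrightarrow> stmt_i) \<and> (stmt_v \<longleftrightarrow> stmt_ii) \<and> (stmt_v \<longleftrightarrow> stmt_iii) \<and> (stmt_v \<longleftrightarrow> stmt_iv)"
proof -
  have i_ii: "stmt_i \<longleftrightarrow> stmt_ii"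
  proof
    assume stmt_i
    \<comment> \<open>The decoder is an inverse of \<open>A\<close> on the sparse vectors, with
      arbitrary values off their image.\<close>
    then have "inj_on ((*v) A) (sparse_vectors s)"
      unfolding stmt_i_def inj_on_def by blast
    then show stmt_ii
      unfolding stmt_ii_def by (metis inv_into_f_f)
  next
    assume stmt_ii
    then show stmt_i unfolding stmt_i_def stmt_ii_def by metis
  qed
  \<comment> \<open>The rest is the cycle (i), (iii), (iv), (v), (i).\<close>
  have i_iii: "stmt_iii" if stmt_i
    using that sparse_injective_imp_kernel_trivial[of s A] unfolding stmt_i_def stmt_iii_def by blast
  have iii_iv: "stmt_iv" if stmt_iii
  proof -
    obtain \<alpha> where \<alpha>: "\<alpha> > 0" "\<And>x. x \<in> sparse_vectors (2 * s) \<Longrightarrow> \<alpha> * norm x \<le> norm (A *v x)"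
      by (rule kernel_trivial_imp_bounded_below[of "2 * s" A])
        (use \<open>stmt_iii\<close> in \<open>auto simp: stmt_iii_def\<close>)
    \<comment> \<open>The upper bound is just boundedness of a linear map and holds for all
      vectors.\<close>
    obtain B where "B > 0" "\<And>x. norm (A *v x) \<le> norm x * B"
      using bounded_linear.pos_bounded[OF matrix_vector_mul_bounded_linear[of A]] by auto
    with \<alpha> show ?thesis unfolding stmt_iv_def by (metis mult.commute)
  qed
  have iv_v: "stmt_v" if stmt_iv
  proof -
    obtain \<alpha> where \<alpha>: "\<alpha> > 0" "\<And>x. x \<in> sparse_vectors (2 * s) \<Longrightarrow> \<alpha> * norm x \<le> norm (A *v x)"
      using \<open>stmt_iv\<close> unfolding stmt_iv_def by blast
    obtain q where q: "0 < q" "q \<le> 1"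
      "\<And>h S. A *v h = 0 \<Longrightarrow> h \<noteq> 0 \<Longrightarrow> card S \<le> s \<Longrightarrow>
         (\<Sum>i\<in>S. \<bar>h $ i\<bar> powr q) < (\<Sum>i\<in>- S. \<bar>h $ i\<bar> powr q)"
      using null_space_property[of \<alpha> s A] \<alpha> by blast
    then have "\<forall>x \<in> sparse_vectors s. lq_argmin q A (A *v x) = {x}"
      using sparse_unique_minimizer[of q A s] by blast
    with q(1,2) show ?thesis unfolding stmt_v_def by blast
  qed
  \<comment> \<open>Equal measurements have the same set of minimizers, which is both
    \<open>{x}\<close> and \<open>{x'}\<close>.\<close>
  have v_i: "stmt_i" if stmt_v
    using that unfolding stmt_i_def stmt_v_def by (metis singleton_inject)
  from i_ii i_iii iii_iv iv_v v_i show ?thesis by blast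
qed

end
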